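(* For $n\ge1$ and $x>0$ let $$P_L=\frac3{32}(2n+1)\big(y_n^2(x)+j_n^2(x)\big),\qquad P_S=\frac3{16}(2n+1)\big(y_n^2(x)-j_n^2(x)\big),\qquad P_T=1+P_S,$$ with $x=k_0R_2$, and suppose $k_0R_2=\beta n$ with $\beta>0$ fixed. Then, as $n\to\infty$, $$\frac{P_L}{P_T}\to\frac12\ \text{ if }\beta<1,\qquad\text{and}\qquad \frac{P_L}{P_T}\to0\ \text{ if }\beta>1.$$
   Context: $j_n$ and $y_n$ are the spherical Bessel functions of the first and second kind. Interpretation: $k_0$ is the free-space wave number; a transmitter in a free-space ball centred at the origin uses the source exciting the spherical vector wave of index $(n,1,1)$, normalized so that the consumed power ignoring back-scattering is $1$; the receiver is a single matched dipole at distance $R_2$ from the origin. $P_L$ is the power delivered to the receiver's load, $P_S$ is the power consumption at the transmitter due to the field back-scattered by the receiving dipole, and $P_T$ is the total power consumption at the transmitter. *)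

theory Defs
  imports "HOL-Analysis.Analysis"
begin

text \<open>
  Bessel function of the first kind of real order, for positive real argument. The reciprocal
  Gamma function vanishes at the poles of Gamma, so the series is the usual one also for
  negative integer orders.
\<close>

definition bessel_J :: "real \<Rightarrow> real \<Rightarrow> real" where
  "bessel_J \<nu> x =
     (\<Sum>k. (-1) ^ k / fact k * rGamma (\<nu> + real k + 1) * (x / 2) powr (2 * real k + \<nu>))"

text \<open>
  Bessel function of the second kind. At integer orders the defining quotient is a removable
  singularity in the order, and the value is its limit.
\<close>

definition bessel_Y :: "real \<Rightarrow> real \<Rightarrow> real" where
  "bessel_Y \<nu> x =
     (let q = (\<lambda>\<mu>. (bessel_J \<mu> x * cos (\<mu> * pi) - bessel_J (- \<mu>) x) / sin (\<mu> * pi))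
      in if \<nu> \<in> \<int> then Lim (at \<nu>) q else q \<nu>)"

definition spherical_j :: "nat \<Rightarrow> real \<Rightarrow> real" where
  "spherical_j n x = sqrt (pi / (2 * x)) * bessel_J (real n + 1 / 2) x"

definition spherical_y :: "nat \<Rightarrow> real \<Rightarrow> real" where
  "spherical_y n x = sqrt (pi / (2 * x)) * bessel_Y (real n + 1 / 2) x"

text \<open>
  Powers for the spherical vector wave source of index (n,1,1), in units of the power consumed
  when back-scattering is ignored; the argument is the product of wave number and distance.
  \<open>P_L\<close> is delivered to the receiver's load, \<open>P_S\<close> is consumed at the transmitter because of
  the back-scattered field, and \<open>P_T\<close> is the total consumption at the transmitter.
\<close>

definition P_L :: "nat \<Rightarrow> real \<Rightarrow> real" where
  "P_L n x = 3 / 32 * (2 * real n + 1) * ((spherical_y n x)\<^sup>2 + (spherical_j n x)\<^sup>2)"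

definition P_S :: "nat \<Rightarrow> real \<Rightarrow> real" where
  "P_S n x = 3 / 16 * (2 * real n + 1) * ((spherical_y n x)\<^sup>2 - (spherical_j n x)\<^sup>2)"

definition P_T :: "nat \<Rightarrow> real \<Rightarrow> real" where
  "P_T n x = 1 + P_S n x"

end

theory Submission
  imports Defs "HOL-Real_Asymp.Real_Asymp"
begin

text \<open>
  By the three-term recurrence in the order, \<open>x\<^sup>2 (y\<^sub>n\<^sup>2 + j\<^sub>n\<^sup>2)\<close> is the polynomial
  \<open>\<Sum>i\<le>n. b\<^sub>i (n+i)!/(n-i)! x\<^bsup>-2i\<^esup>\<close> with \<open>b\<^sub>i = (1/2)\<^sub>i / i!\<close>. For \<open>x = \<beta> n\<close> and \<open>\<beta> > 1\<close> a
  geometric series bounds it, so both \<open>P_L\<close> and \<open>P_S\<close> are \<open>O(1/n)\<close>. For \<open>\<beta> < 1\<close> the single term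
  with \<open>i\<close> a small fixed fraction of \<open>n\<close> is already exponentially large, while \<open>j\<^sub>n\<close> stays bounded:
  \<open>\<bar>j\<^sub>k(x)\<bar>\<close> decreases in \<open>k\<close> from about \<open>k = x\<close> on, where the polynomial controls it. Hence
  \<open>y\<^sub>n\<^sup>2\<close> dominates and \<open>P_L / P_T\<close> tends to \<open>(3/32) / (3/16)\<close>.
\<close>

section \<open>Power series of \<open>bessel_J\<close> and the three-term recurrence in the
  order\<close>

definition bessel_term :: "real \<Rightarrow> real \<Rightarrow> nat \<Rightarrow> real" where
  "bessel_term \<nu> x k =
     (-1) ^ k / fact k * rGamma (\<nu> + real k + 1) * (x / 2) powr (2 * real k + \<nu>)"

lemma bessel_J_eq: "bessel_J \<nu> x = (\<Sum>k. bessel_term \<nu> x k)"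
  by (simp add: bessel_J_def bessel_term_def)

text \<open>Rests on \<open>rGamma z = z * rGamma (z + 1)\<close>, which has no exceptional points.
  The form without quotients stays valid where \<open>\<nu> + real k + 1\<close> vanishes.\<close>

lemma bessel_term_Suc_index:
  assumes "x > 0"
  shows "bessel_term \<nu> x k * (x / 2)\<^sup>2 =
    - (bessel_term \<nu> x (Suc k) * ((real k + 1) * (\<nu> + real k + 1)))"
proof -
  have G: "rGamma (\<nu> + real k + 1) = (\<nu> + real k + 1) * rGamma (\<nu> + real (Suc k) + 1)"
    using rGamma_plus1[of "\<nu> + real k + 1"] by (simp add: add_ac)
  have "2 * real (Suc k) + \<nu> = (2 * real k + \<nu>) + real 2" by simp
  hence P: "(x / 2) powr (2 * real (Suc k) + \<nu>) = (x / 2) powr (2 * real k + \<nu>) * (x / 2)\<^sup>2"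
    using assms by (simp only: powr_add) (simp add: powr_realpow)
  show ?thesis
    unfolding bessel_term_def G P by (simp add: divide_simps) (simp add: algebra_simps)
qed

lemma bessel_term_Suc_order:
  assumes "x > 0"
  shows "bessel_term \<nu> x k * (x / 2) = (\<nu> + real k + 1) * bessel_term (\<nu> + 1) x k"
proof -
  have G: "rGamma (\<nu> + real k + 1) = (\<nu> + real k + 1) * rGamma (\<nu> + 1 + real k + 1)"
    using rGamma_plus1[of "\<nu> + real k + 1"] by (simp add: add_ac)
  have "2 * real k + (\<nu> + 1) = (2 * real k + \<nu>) + 1" by simp
  hence P: "(x / 2) powr (2 * real k + (\<nu> + 1)) = (x / 2) powr (2 * real k + \<nu>) * (x / 2)"
    using assms by (simp only: powr_add) simp
  show ?thesis
    unfolding bessel_term_def G P by simp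
qed

lemma summable_norm_bessel_term:
  assumes x: "x > 0"
  shows "summable (\<lambda>k. norm (bessel_term \<nu> x k))"
proof -
  \<comment> \<open>From \<open>N\<close> on, \<open>\<nu> + real k + 1\<close> exceeds twice the
    square of \<open>x / 2\<close>, so each term is at most half the previous one in absolute
    value.\<close>
  define N where "N = nat \<lceil>\<bar>\<nu>\<bar> + 2 * (x / 2)\<^sup>2\<rceil>"
  have N: "real N \<ge> \<bar>\<nu>\<bar> + 2 * (x / 2)\<^sup>2"
    unfolding N_def by linarith
  show ?thesis
  proof (rule summable_ratio_test[of "1/2" N])
    fix k assume "N \<le> k"
    hence k: "real k \<ge> \<bar>\<nu>\<bar> + 2 * (x / 2)\<^sup>2" using N by linarith
    let ?b = "\<bar>bessel_term \<nu> x (Suc k)\<bar>" and ?a = "\<bar>bessel_term \<nu> x k\<bar>"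
    have pos: "\<nu> + real k + 1 > 0" using k by (smt (verit) zero_le_power2)
    have "?a * (x/2)\<^sup>2 = \<bar>bessel_term \<nu> x k * (x / 2)\<^sup>2\<bar>" by (simp add: abs_mult)
    also have "\<dots> = ?b * ((real k + 1) * (\<nu> + real k + 1))"
      unfolding bessel_term_Suc_index[OF x] using pos by (simp add: abs_mult)
    finally have eq: "?a * (x/2)\<^sup>2 = ?b * ((real k + 1) * (\<nu> + real k + 1))" .
    have "2 * (x/2)\<^sup>2 \<le> \<nu> + real k + 1" using k by linarith
    also have "\<dots> \<le> (real k + 1) * (\<nu> + real k + 1)" using pos by simp
    finally have "?b * (2 * (x/2)\<^sup>2) \<le> ?b * ((real k + 1) * (\<nu> + real k + 1))"
      by (rule mult_left_mono) simp
    hence "(2 * ?b) * (x/2)\<^sup>2 \<le> ?a * (x/2)\<^sup>2" using eq by simp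
    hence "2 * ?b \<le> ?a" using x by (simp add: mult_le_cancel_right)
    thus "norm (norm (bessel_term \<nu> x (Suc k))) \<le> 1/2 * norm (norm (bessel_term \<nu> x k))"
      by simp
  qed simp
qed

lemma summable_bessel_term: "x > 0 \<Longrightarrow> summable (bessel_term \<nu> x)"
  by (rule summable_norm_cancel[OF summable_norm_bessel_term])

text \<open>Holds term by term after scaling by \<open>x / 2\<close>: relative to term
  \<open>k\<close> at order \<open>\<nu>\<close>, order \<open>\<nu> - 1\<close> contributes the
  factor \<open>\<nu> + k\<close>, and order \<open>\<nu> + 1\<close>, delayed by one index to align
  the powers of \<open>x\<close>, contributes \<open>- k\<close>.\<close>

lemma bessel_J_recurrence:
  assumes x: "x > 0"
  shows "bessel_J (\<nu> - 1) x + bessel_J (\<nu> + 1) x = 2 * \<nu> / x * bessel_J \<nu> x"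
proof -
  have T: "x / 2 * (bessel_term (\<nu> - 1) x k + (case k of 0 \<Rightarrow> 0 | Suc j \<Rightarrow> bessel_term (\<nu> + 1) x j))
      = \<nu> * bessel_term \<nu> x k" for k
  proof -
    have 1: "x / 2 * bessel_term (\<nu> - 1) x k = (\<nu> + real k) * bessel_term \<nu> x k"
      using bessel_term_Suc_order[OF x, of "\<nu> - 1" k] by (simp add: algebra_simps)
    show ?thesis
    proof (cases k)
      case 0
      thus ?thesis using 1 by simp
    next
      case (Suc j)
      have 2: "x / 2 * bessel_term (\<nu> + 1) x j = - (real k * bessel_term \<nu> x k)"
      proof -
        have "2 * real j + (\<nu> + 1) + 1 = 2 * real k + \<nu>" using Suc by simp
        hence P: "(x / 2) powr (2 * real k + \<nu>) = (x / 2) powr (2 * real j + (\<nu> + 1)) * (x / 2)"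
          using x by (metis powr_add powr_one half_gt_zero less_imp_le)
        have G: "\<nu> + 1 + real j + 1 = \<nu> + real k + 1" using Suc by simp
        show ?thesis unfolding bessel_term_def P G using Suc by (simp add: divide_simps)
      qed
      show ?thesis
        unfolding Suc distrib_left nat.case 1[unfolded Suc] 2[unfolded Suc] by (simp add: distrib_right)
    qed
  qed
  let ?c = "\<lambda>k. case k of 0 \<Rightarrow> 0 | Suc j \<Rightarrow> bessel_term (\<nu> + 1) x j"
  have "?c sums bessel_J (\<nu> + 1) x"
    using sums_Suc_iff[of ?c "bessel_J (\<nu> + 1) x"]
      summable_sums[OF summable_bessel_term[OF x, of "\<nu> + 1"]]
    by (simp add: bessel_J_eq)
  hence "(\<lambda>k. x / 2 * (bessel_term (\<nu> - 1) x k + ?c k)) sums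
      (x / 2 * (bessel_J (\<nu> - 1) x + bessel_J (\<nu> + 1) x))"
    using summable_sums[OF summable_bessel_term[OF x]]
    by (intro sums_mult sums_add) (simp_all add: bessel_J_eq)
  moreover have "(\<lambda>k. \<nu> * bessel_term \<nu> x k) sums (\<nu> * bessel_J \<nu> x)"
    using summable_sums[OF summable_bessel_term[OF x]]
    by (intro sums_mult) (simp add: bessel_J_eq)
  ultimately have "x / 2 * (bessel_J (\<nu> - 1) x + bessel_J (\<nu> + 1) x) = \<nu> * bessel_J \<nu> x"
    unfolding T by (rule sums_unique2)
  thus ?thesis using x by (simp add: field_simps)
qed

section \<open>Half-integer orders, and decay as the order grows\<close>

lemma rGamma_half_integer:
  "rGamma (real k + 1 / 2) = 4 ^ k * fact k / (sqrt pi * fact (2 * k))"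
proof (induction k)
  case 0
  show ?case by (simp add: rGamma_inverse_Gamma Gamma_one_half_real inverse_eq_divide)
next
  case (Suc k)
  have "rGamma (real k + 1 / 2) = (real k + 1 / 2) * rGamma (real (Suc k) + 1 / 2)"
    using rGamma_plus1[of "real k + 1/2"] by (simp add: add_ac)
  hence "rGamma (real (Suc k) + 1 / 2) = rGamma (real k + 1 / 2) / (real k + 1 / 2)"
    by (simp add: field_simps)
  hence R: "rGamma (real (Suc k) + 1 / 2) = 4 ^ k * fact k / (sqrt pi * fact (2 * k)) / (real k + 1 / 2)"
    unfolding Suc.IH .
  have F: "(fact (2 * Suc k) :: real) = 4 * (real k + 1 / 2) * (real k + 1) * fact (2 * k)"
    "(fact (Suc k) :: real) = (real k + 1) * fact k"
    by (simp_all add: algebra_simps)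
  have gen: "4 ^ k * f / (s * g) / a = 4 ^ Suc k * (b * f) / (s * (4 * a * b * g))"
    if "b \<noteq> 0" for a b f g s :: real
    using that by simp
  have "real k + 1 \<noteq> 0" by linarith
  thus ?case unfolding R F by (rule gen)
qed

text \<open>The half-integer values of \<open>rGamma\<close> replace \<open>fact k\<close> by
  \<open>fact (2 * k)\<close>, which turns the series into that of the cosine. The sine at order
  \<open>1 / 2\<close> arises in the same way.\<close>

lemma bessel_J_minus_half:
  assumes x: "x > 0"
  shows "bessel_J (- (1 / 2)) x = cos x / sqrt (pi * x / 2)"
proof -
  have "bessel_term (- (1/2)) x k = (-1) ^ k / fact (2 * k) * x ^ (2 * k) / sqrt (pi * x / 2)" for k
  proof -
    have e: "2 * real k + - (1/2) = real (2 * k) - 1 / 2" by simp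
    have P: "(x / 2) powr (2 * real k + - (1/2)) = (x / 2) ^ (2 * k) / sqrt (x / 2)"
      unfolding e powr_diff using x by (simp only: powr_half_sqrt powr_realpow half_gt_zero half_gt_zero[THEN less_imp_le])
    have G: "- (1/2) + real k + 1 = real k + 1 / 2" by simp
    have F: "x ^ (2 * k) = 4 ^ k * (x / 2) ^ (2 * k)"
      by (simp add: power_mult power_divide)
    show ?thesis
      unfolding bessel_term_def P G rGamma_half_integer F using x
      by (simp add: real_sqrt_mult real_sqrt_divide mult_ac)
  qed
  moreover have "(\<lambda>k. (-1) ^ k / fact (2 * k) * x ^ (2 * k) / sqrt (pi * x / 2)) sums
      (cos x / sqrt (pi * x / 2))"
    by (intro sums_divide cos_paired)
  ultimately have "bessel_term (- (1 / 2)) x sums (cos x / sqrt (pi * x / 2))" by (simp only: sums_def)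
  thus ?thesis unfolding bessel_J_eq by (rule sums_unique[symmetric])
qed

lemma bessel_J_half:
  assumes x: "x > 0"
  shows "bessel_J (1 / 2) x = sin x / sqrt (pi * x / 2)"
proof -
  have "bessel_term (1/2) x k = (-1) ^ k / fact (2 * k + 1) * x ^ (2 * k + 1) / sqrt (pi * x / 2)" for k
  proof -
    have e: "2 * real k + 1/2 = real (2 * k + 1) - 1 / 2" by simp
    have P: "(x / 2) powr (2 * real k + 1/2) = (x / 2) ^ (2 * k + 1) / sqrt (x / 2)"
      unfolding e powr_diff using x by (simp only: powr_half_sqrt powr_realpow half_gt_zero half_gt_zero[THEN less_imp_le])
    have G: "1/2 + real k + 1 = real (Suc k) + 1 / 2" by simp
    have F: "x ^ (2 * k + 1) = 2 * 4 ^ k * (x / 2) ^ (2 * k + 1)"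
      by (simp add: power_mult power_divide)
    have R: "rGamma (real (Suc k) + 1 / 2) = 2 * 4 ^ k * fact k / (sqrt pi * fact (2 * k + 1))"
      unfolding rGamma_half_integer by (simp add: divide_simps)
    show ?thesis
      unfolding bessel_term_def P G R F using x
      by (simp add: real_sqrt_mult real_sqrt_divide mult_ac)
  qed
  moreover have "(\<lambda>k. (-1) ^ k / fact (2 * k + 1) * x ^ (2 * k + 1) / sqrt (pi * x / 2)) sums
      (sin x / sqrt (pi * x / 2))"
    by (intro sums_divide sin_paired)
  ultimately have "bessel_term (1 / 2) x sums (sin x / sqrt (pi * x / 2))" by (simp only: sums_def)
  thus ?thesis unfolding bessel_J_eq by (rule sums_unique[symmetric])
qed

text \<open>Raising the order from \<open>\<nu> + n\<close> by one multiplies each term by at most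
  \<open>(x / 2) / (n + 1)\<close> in absolute value, so the whole series is dominated by
  \<open>(x / 2) ^ n / fact n\<close>. This later identifies \<open>spherical_j\<close> as the
  decaying solution of the recurrence.\<close>

lemma bessel_J_tendsto_0_order:
  assumes x: "x > 0" and \<nu>: "\<nu> \<ge> 0"
  shows "(\<lambda>n. bessel_J (\<nu> + real n) x) \<longlonglongrightarrow> 0"
proof -
  define S where "S = (\<Sum>k. norm (bessel_term \<nu> x k))"
  have T: "norm (bessel_term (\<nu> + real n) x k) \<le> norm (bessel_term \<nu> x k) * ((x / 2) ^ n / fact n)" for n k
  proof (induction n)
    case (Suc n)
    let ?b = "bessel_term (\<nu> + real (Suc n)) x k"
    have "(\<nu> + real n + real k + 1) * \<bar>?b\<bar> = \<bar>bessel_term (\<nu> + real n) x k\<bar> * (x / 2)"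
      using arg_cong[OF bessel_term_Suc_order[OF x, of "\<nu> + real n" k], of abs] x \<nu>
      by (simp add: abs_mult add_ac)
    moreover have "(real n + 1) * \<bar>?b\<bar> \<le> (\<nu> + real n + real k + 1) * \<bar>?b\<bar>"
      using \<nu> by (intro mult_right_mono) auto
    ultimately have "(real n + 1) * \<bar>?b\<bar> \<le> \<bar>bessel_term (\<nu> + real n) x k\<bar> * (x / 2)" by simp
    also have "\<dots> \<le> (\<bar>bessel_term \<nu> x k\<bar> * ((x / 2) ^ n / fact n)) * (x / 2)"
      using Suc.IH x by (intro mult_right_mono) auto
    finally have "\<bar>?b\<bar> \<le> (\<bar>bessel_term \<nu> x k\<bar> * ((x / 2) ^ n / fact n)) * (x / 2) / (real n + 1)"
      by (subst pos_le_divide_eq) (simp_all add: mult.commute)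
    also have "\<dots> = \<bar>bessel_term \<nu> x k\<bar> * ((x / 2) ^ Suc n / fact (Suc n))"
      by (simp add: field_simps)
    finally show ?case by simp
  qed simp
  have "norm (bessel_J (\<nu> + real n) x) \<le> S * ((x / 2) ^ n / fact n)" for n
  proof -
    have "norm (bessel_J (\<nu> + real n) x) \<le> (\<Sum>k. norm (bessel_term (\<nu> + real n) x k))"
      unfolding bessel_J_eq by (rule summable_norm[OF summable_norm_bessel_term[OF x]])
    also have "\<dots> \<le> (\<Sum>k. norm (bessel_term \<nu> x k) * ((x / 2) ^ n / fact n))"
      by (intro suminf_le T summable_norm_bessel_term x summable_mult2)
    also have "\<dots> = S * ((x / 2) ^ n / fact n)"
      unfolding S_def by (rule suminf_mult2[symmetric, OF summable_norm_bessel_term[OF x]])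
    finally show ?thesis .
  qed
  moreover have "(\<lambda>n. S * ((x / 2) ^ n / fact n)) \<longlonglongrightarrow> 0"
    using tendsto_mult_right_zero[OF summable_LIMSEQ_zero[OF summable_exp[of "x / 2"]], of S]
    by (simp only: divide_inverse mult.commute)
  ultimately show ?thesis by (rule Lim_null_comparison[OF always_eventually[OF allI]])
qed

section \<open>The coefficients of the polynomial in \<open>1 / x\<close>\<close>

text \<open>These are the central binomial coefficients divided by \<open>4 ^ i\<close>, the Taylor
  coefficients of \<open>(1 - z) powr (- 1 / 2)\<close>.\<close>

definition half_binomial :: "nat \<Rightarrow> real" where
  "half_binomial i = pochhammer (1 / 2) i / fact i"

text \<open>For integers \<open>t = n \<ge> i\<close> this is \<open>(n+i)!/(n-i)!\<close>.\<close>

definition falling_rising :: "real \<Rightarrow> nat \<Rightarrow> real" where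
  "falling_rising t i = (\<Prod>l<i. (t - real l) * (t + real l + 1))"

lemma half_binomial_Suc:
  "half_binomial (Suc i) * (2 * real i + 2) = half_binomial i * (2 * real i + 1)"
  by (simp add: half_binomial_def pochhammer_rec' divide_simps) (simp add: algebra_simps)

text \<open>Consecutive values have ratio \<open>(2 * i + 1) / (2 * i + 2)\<close>. The lower bound
  is crude, but it loses only a factor linear in \<open>i\<close>, harmless against exponential
  growth.\<close>

lemma half_binomial_le_1: "half_binomial i \<le> 1"
  and half_binomial_ge: "half_binomial i \<ge> 1 / (2 * real i + 1)"
proof (induction i)
  case (Suc i)
  have S: "half_binomial (Suc i) = half_binomial i * (2 * real i + 1) / (2 * real i + 2)"
    using half_binomial_Suc[of i] by (simp add: field_simps)
  {
    case 1
    have "half_binomial i * (2 * real i + 1) \<le> 1 * (2 * real i + 1)"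
      using Suc.IH(1) by (intro mult_right_mono) auto
    also have "\<dots> \<le> 2 * real i + 2" by simp
    finally show ?case unfolding S by (simp add: divide_le_eq)
  next
    case 2
    have "1 \<le> half_binomial i * (2 * real i + 1)"
      using Suc.IH(2) by (simp add: pos_divide_le_eq)
    hence "1 / (2 * real i + 2) \<le> half_binomial (Suc i)"
      unfolding S by (intro divide_right_mono) auto
    moreover have "1 / (2 * real (Suc i) + 1) \<le> 1 / (2 * real i + 2)"
      by (intro divide_left_mono) auto
    ultimately show ?case by linarith
  }
qed (auto simp: half_binomial_def)

lemma half_binomial_pos: "half_binomial i > 0"
  using half_binomial_ge[of i] by (smt (verit) divide_pos_pos of_nat_0_le_iff)

lemma falling_rising_0 [simp]: "falling_rising t 0 = 1"
  by (simp add: falling_rising_def)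

lemma falling_rising_Suc:
  "falling_rising t (Suc i) = falling_rising t i * ((t - real i) * (t + real i + 1))"
  by (simp add: falling_rising_def)

text \<open>Allows sums over \<open>i \<le> n\<close> to be extended to a larger common upper
  limit.\<close>

lemma falling_rising_of_nat_eq_0: "n < i \<Longrightarrow> falling_rising (real n) i = 0"
  by (auto simp: falling_rising_def)

lemma falling_rising_minus_1: "0 < i \<Longrightarrow> falling_rising (- 1) i = 0"
  by (auto simp: falling_rising_def intro!: bexI[of _ 0])

text \<open>\<open>falling_rising t i\<close> is the product of the \<open>2 * i\<close> consecutive
  factors from \<open>t - i + 1\<close> to \<open>t + i\<close>. Raising \<open>t\<close> and
  \<open>i\<close> together by one appends two factors at the upper end; the next two lemmas compare
  such ranges likewise.\<close>

lemma falling_rising_up: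
  "falling_rising (t + 1) (Suc i) = falling_rising t i * ((t + 1 + real i) * (t + 2 + real i))"
proof (induction i)
  case (Suc i)
  show ?case
    unfolding falling_rising_Suc[of "t + 1" "Suc i"] Suc.IH falling_rising_Suc[of t i]
    by (simp add: algebra_simps)
qed (simp add: falling_rising_Suc algebra_simps)

lemma falling_rising_down:
  "falling_rising (t - 1) (Suc i) = falling_rising t i * ((t - real i) * (t - real i - 1))"
proof (induction i)
  case (Suc i)
  show ?case
    unfolding falling_rising_Suc[of "t - 1" "Suc i"] Suc.IH falling_rising_Suc[of t i]
    by (simp add: algebra_simps)
qed (simp add: falling_rising_Suc algebra_simps)

lemma falling_rising_shift:
  "falling_rising (t - 1) i * (t + real i) = falling_rising t i * (t - real i)"
proof (cases i)
  case (Suc j)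
  show ?thesis
    unfolding Suc falling_rising_down unfolding falling_rising_Suc by (simp add: algebra_simps)
qed simp

text \<open>
  For two solutions of the recurrence, both the sums of squares and the sums of products of
  neighbours are explicit polynomials in \<open>1/x\<close>; these two families determine each other.
\<close>

lemma sum_squares_of_recurrence:
  fixes F G :: "nat \<Rightarrow> real"
  assumes x: "x > 0"
    and F: "\<And>n. F (Suc (Suc n)) = (2 * real n + 1) / x * F (Suc n) - F n"
    and G: "\<And>n. G (Suc (Suc n)) = (2 * real n + 1) / x * G (Suc n) - G n"
    and init: "(F 0)\<^sup>2 + (G 0)\<^sup>2 = K" "(F 1)\<^sup>2 + (G 1)\<^sup>2 = K" "F 0 * F 1 + G 0 * G 1 = 0"
  shows "(F (Suc n))\<^sup>2 + (G (Suc n))\<^sup>2 =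
    K * (\<Sum>i\<le>n. half_binomial i * falling_rising (real n) i / x ^ (2 * i))"
proof -
  \<comment> \<open>One fixed summation limit for all indices \<open>m \<le> N\<close>, so that sums
    belonging to neighbouring indices can be combined term by term.\<close>
  define N where "N = n"
  define A where "A = (\<lambda>t. \<Sum>i\<le>N. half_binomial i * falling_rising t i / x ^ (2 * i))"
  \<comment> \<open>\<open>K * B (m - 1)\<close> will be the sum of products of neighbours at
    \<open>m\<close> and \<open>m + 1\<close>, and \<open>K * A m\<close> the sum of squares at
    \<open>m + 1\<close>.\<close>
  define B where "B = (\<lambda>t. (\<Sum>i<N. half_binomial i * falling_rising t i * (t + 1 + real i) / x ^ (2 * i)) / x)"
  \<comment> \<open>The top term of \<open>A\<close> vanishes for \<open>m < N\<close>, which gives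
    \<open>A\<close> the same summation range as \<open>B\<close>.\<close>
  have AN: "A (real m) = (\<Sum>i<N. half_binomial i * falling_rising (real m) i / x ^ (2 * i))"
    if "m < N" for m
    unfolding A_def lessThan_Suc_atMost[symmetric] using that
    by (simp add: falling_rising_of_nat_eq_0)
  have B_rec: "B (real m) + B (real m - 1) = (2 * real m + 1) / x * A (real m)" if "m < N" for m
  proof -
    have "half_binomial i * falling_rising (real m) i * (real m + 1 + real i) / x ^ (2 * i)
      + half_binomial i * falling_rising (real m - 1) i * (real m - 1 + 1 + real i) / x ^ (2 * i)
      = (2 * real m + 1) * (half_binomial i * falling_rising (real m) i / x ^ (2 * i))" for i
    proof -
      have "half_binomial i * falling_rising (real m) i * (real m + 1 + real i)
        + half_binomial i * (falling_rising (real m - 1) i * (real m + real i))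
        = (2 * real m + 1) * (half_binomial i * falling_rising (real m) i)"
        unfolding falling_rising_shift by (simp add: algebra_simps)
      thus ?thesis by (simp add: add_divide_distrib[symmetric] mult.assoc)
    qed
    hence "(\<Sum>i<N. half_binomial i * falling_rising (real m) i * (real m + 1 + real i) / x ^ (2 * i))
      + (\<Sum>i<N. half_binomial i * falling_rising (real m - 1) i * (real m - 1 + 1 + real i) / x ^ (2 * i))
      = (2 * real m + 1) * A (real m)"
      unfolding AN[OF that] by (simp only: sum.distrib[symmetric] sum_distrib_left)
    thus ?thesis
      unfolding B_def by (simp only: add_divide_distrib[symmetric] times_divide_eq_left)
  qed
  have A_rec: "A (t + 1) = A (t - 1) + (2 * t + 1) / x * (B t - B (t - 1))" for t
  proof -
    have 1: "half_binomial (Suc i) * falling_rising (t + 1) (Suc i) / x ^ (2 * Suc i)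
        - half_binomial (Suc i) * falling_rising (t - 1) (Suc i) / x ^ (2 * Suc i)
      = (2 * t + 1) / x * ((half_binomial i * falling_rising t i * (t + 1 + real i) / x ^ (2 * i)
        - half_binomial i * falling_rising (t - 1) i * (t - 1 + 1 + real i) / x ^ (2 * i)) / x)" for i
    proof -
      have "half_binomial (Suc i) * falling_rising (t + 1) (Suc i)
        - half_binomial (Suc i) * falling_rising (t - 1) (Suc i)
        = (half_binomial (Suc i) * (2 * real i + 2)) * falling_rising t i * (2 * t + 1)"
        unfolding falling_rising_up falling_rising_down by (simp add: algebra_simps)
      also have "\<dots> = (2 * t + 1) * (half_binomial i * falling_rising t i * (t + 1 + real i)
        - half_binomial i * (falling_rising t i * (t - real i)))"
        unfolding half_binomial_Suc by (simp add: algebra_simps)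
      also have "\<dots> = (2 * t + 1) * (half_binomial i * falling_rising t i * (t + 1 + real i)
        - half_binomial i * falling_rising (t - 1) i * (t - 1 + 1 + real i))"
        unfolding falling_rising_shift[symmetric] by simp
      finally show ?thesis
        by (simp add: diff_divide_distrib[symmetric] power2_eq_square mult.assoc)
    qed
    \<comment> \<open>The terms of index 0 agree and cancel, leaving only indices
      \<open>Suc i\<close>.\<close>
    have "A (t + 1) - A (t - 1) = (\<Sum>i<N. half_binomial (Suc i) * falling_rising (t + 1) (Suc i) / x ^ (2 * Suc i)
        - half_binomial (Suc i) * falling_rising (t - 1) (Suc i) / x ^ (2 * Suc i))"
      unfolding A_def lessThan_Suc_atMost[symmetric] sum.lessThan_Suc_shift
      by (simp add: sum_subtractf)
    also have "\<dots> = (2 * t + 1) / x * (B t - B (t - 1))"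
      unfolding 1 B_def
      by (simp add: sum_distrib_left sum_divide_distrib sum_subtractf diff_divide_distrib right_diff_distrib)
    finally show ?thesis by simp
  qed
  \<comment> \<open>The three claims are carried together: the recurrence gives the new product from
    the old squares and product, and then the new square, matching \<open>B_rec\<close> and
    \<open>A_rec\<close>.\<close>
  have "m \<le> N \<Longrightarrow> (F m)\<^sup>2 + (G m)\<^sup>2 = K * A (real m - 1) \<and> (F (Suc m))\<^sup>2 + (G (Suc m))\<^sup>2 = K * A (real m)
     \<and> F m * F (Suc m) + G m * G (Suc m) = K * B (real m - 1)" for m
  proof (induction m)
    case 0
    have "A (real 0) = 1" "A (- 1) = 1"
      unfolding A_def lessThan_Suc_atMost[symmetric] sum.lessThan_Suc_shift
      using falling_rising_of_nat_eq_0[of 0]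
      by (simp_all add: falling_rising_minus_1 half_binomial_def)
    \<comment> \<open>The last factor equals \<open>i\<close> and kills the term of index 0; the
      product \<open>falling_rising (- 1) i\<close> kills all others.\<close>
    moreover have "half_binomial i * falling_rising (- 1) i * (- 1 + 1 + real i) = 0" for i
      by (cases i) (simp_all add: falling_rising_minus_1)
    hence "B (- 1) = 0" unfolding B_def by (simp only: div_0 sum.neutral_const)
    ultimately show ?case using init by simp
  next
    case (Suc m)
    define a where "a = (2 * real m + 1) / x"
    have IH: "(F m)\<^sup>2 + (G m)\<^sup>2 = K * A (real m - 1)" "(F (Suc m))\<^sup>2 + (G (Suc m))\<^sup>2 = K * A (real m)"
       "F m * F (Suc m) + G m * G (Suc m) = K * B (real m - 1)"
      using Suc by auto
    have B': "B (real m) = a * A (real m) - B (real m - 1)"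
      using B_rec[of m] Suc.prems unfolding a_def by simp
    have "F (Suc m) * F (Suc (Suc m)) + G (Suc m) * G (Suc (Suc m))
      = a * ((F (Suc m))\<^sup>2 + (G (Suc m))\<^sup>2) - (F m * F (Suc m) + G m * G (Suc m))"
      unfolding F[of m] G[of m] a_def[symmetric] by (simp add: algebra_simps power2_eq_square)
    also have "\<dots> = K * B (real m)"
      unfolding IH B' by (simp add: algebra_simps)
    finally have 1: "F (Suc m) * F (Suc (Suc m)) + G (Suc m) * G (Suc (Suc m)) = K * B (real m)" .
    have "(F (Suc (Suc m)))\<^sup>2 + (G (Suc (Suc m)))\<^sup>2 = ((F m)\<^sup>2 + (G m)\<^sup>2)
      + a * (a * ((F (Suc m))\<^sup>2 + (G (Suc m))\<^sup>2) - 2 * (F m * F (Suc m) + G m * G (Suc m)))"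
      unfolding F[of m] G[of m] a_def[symmetric] by (simp add: algebra_simps power2_eq_square)
    also have "\<dots> = K * A (real m + 1)"
      unfolding IH A_rec a_def[symmetric] B' by (simp add: algebra_simps)
    finally show ?case using 1 IH by (simp add: add.commute)
  qed
  from this[of n] show ?thesis by (simp add: A_def N_def)
qed

section \<open>The polynomial for the sum of squares of \<open>spherical_y\<close> and
  \<open>spherical_j\<close>\<close>

lemma bessel_J_half_integer_recurrence:
  assumes "x > 0"
  shows "bessel_J (real (Suc (Suc n)) - 1 / 2) x
    = (2 * real n + 1) / x * bessel_J (real (Suc n) - 1 / 2) x - bessel_J (real n - 1 / 2) x"
  using bessel_J_recurrence[OF assms, of "real n + 1 / 2"] by (simp add: algebra_simps)

text \<open>At a half-integer order the cosine in the quotient defining \<open>bessel_Y\<close> is 0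
  and the sine is 1 or -1, so only the negative order survives.\<close>

lemma spherical_y_eq:
  "spherical_y n x = sqrt (pi / (2 * x)) * ((- 1) ^ Suc n * bessel_J (1 / 2 - real (Suc n)) x)"
proof -
  have "real n + 1 / 2 \<notin> \<int>"
  proof
    assume "real n + 1 / 2 \<in> \<int>"
    then obtain z where "real n + 1 / 2 = of_int z" by (auto elim: Ints_cases)
    hence "real_of_int (2 * z) = real_of_int (2 * int n + 1)" by simp
    hence "2 * z = 2 * int n + 1" by (simp only: of_int_eq_iff)
    thus False by presburger
  qed
  moreover have "sin ((real n + 1 / 2) * pi) = (- 1) ^ n" "cos ((real n + 1 / 2) * pi) = 0"
    by (simp_all add: distrib_right sin_add cos_add)
  moreover have "- (real n + 1 / 2) = 1 / 2 - real (Suc n)" by simp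
  ultimately have "bessel_Y (real n + 1 / 2) x = - bessel_J (1 / 2 - real (Suc n)) x / (- 1) ^ n"
    unfolding bessel_Y_def Let_def by (simp only: if_False mult_zero_right diff_0)
  thus ?thesis
    unfolding spherical_y_def by (cases "even n") simp_all
qed

lemma spherical_sum_squares:
  assumes x: "x > 0"
  shows "(spherical_y n x)\<^sup>2 + (spherical_j n x)\<^sup>2 =
    (\<Sum>i\<le>n. half_binomial i * falling_rising (real n) i / x ^ (2 * i)) / x\<^sup>2"
proof -
  \<comment> \<open>Indexed one step behind \<open>spherical_j\<close> and
    \<open>spherical_y\<close>, so that both sequences start at the orders \<open>1 / 2\<close> and
    \<open>- 1 / 2\<close>, known in closed form. The alternating sign in \<open>G\<close> makes the
    recurrence for descending orders agree with that of \<open>F\<close>.\<close>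
  define F where "F = (\<lambda>n. bessel_J (real n - 1 / 2) x)"
  define G where "G = (\<lambda>n. (- 1) ^ n * bessel_J (1 / 2 - real n) x)"
  have F01: "F 0 = cos x / sqrt (pi * x / 2)" "F 1 = sin x / sqrt (pi * x / 2)"
    unfolding F_def using bessel_J_minus_half[OF x] bessel_J_half[OF x] by simp_all
  have G01: "G 0 = sin x / sqrt (pi * x / 2)" "G 1 = - cos x / sqrt (pi * x / 2)"
    unfolding G_def using bessel_J_minus_half[OF x] bessel_J_half[OF x] by simp_all
  have squares: "(F (Suc n))\<^sup>2 + (G (Suc n))\<^sup>2 = (2 / (pi * x)) *
      (\<Sum>i\<le>n. half_binomial i * falling_rising (real n) i / x ^ (2 * i))"
  proof (rule sum_squares_of_recurrence[OF x])
    show "F (Suc (Suc n)) = (2 * real n + 1) / x * F (Suc n) - F n" for n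
      unfolding F_def by (rule bessel_J_half_integer_recurrence[OF x])
    show "G (Suc (Suc n)) = (2 * real n + 1) / x * G (Suc n) - G n" for n
    proof -
      have "bessel_J (1 / 2 - real n) x + bessel_J (1 / 2 - real (Suc (Suc n))) x
          = - ((2 * real n + 1) / x * bessel_J (1 / 2 - real (Suc n)) x)"
      proof -
        have "1 / 2 - real (Suc n) - 1 = 1 / 2 - real (Suc (Suc n))"
          "1 / 2 - real (Suc n) + 1 = 1 / 2 - real n" "2 * (1 / 2 - real (Suc n)) = - (2 * real n + 1)"
          by simp_all
        from bessel_J_recurrence[OF x, of "1 / 2 - real (Suc n)", unfolded this] show ?thesis
          by (simp only: minus_divide_left[symmetric] minus_mult_left[symmetric] add.commute)
      qed
      thus ?thesis unfolding G_def by (cases "even n") simp_all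
    qed
    show "(F 0)\<^sup>2 + (G 0)\<^sup>2 = 2 / (pi * x)" "(F 1)\<^sup>2 + (G 1)\<^sup>2 = 2 / (pi * x)"
      unfolding F01 G01 power_divide power2_minus add_divide_distrib[symmetric]
        sin_cos_squared_add sin_cos_squared_add2 using x by simp_all
    show "F 0 * F 1 + G 0 * G 1 = 0"
      unfolding F01 G01 by simp
  qed
  have "spherical_j n x = sqrt (pi / (2 * x)) * F (Suc n)"
    unfolding spherical_j_def F_def by (simp add: algebra_simps)
  moreover have "spherical_y n x = sqrt (pi / (2 * x)) * G (Suc n)"
    unfolding spherical_y_eq G_def ..
  ultimately have "(spherical_y n x)\<^sup>2 + (spherical_j n x)\<^sup>2
      = (sqrt (pi / (2 * x)))\<^sup>2 * ((F (Suc n))\<^sup>2 + (G (Suc n))\<^sup>2)"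
    by (simp only: power_mult_distrib distrib_left add.commute)
  also have "(sqrt (pi / (2 * x)))\<^sup>2 = pi / (2 * x)" using x by simp
  also note squares
  finally show ?thesis using x by (simp add: power2_eq_square)
qed

section \<open>Decay of \<open>spherical_j\<close> in its index\<close>

text \<open>
  The recurrence has a growing and a decaying solution where its coefficient is at least 2;
  a solution tending to zero must be the decaying one from the start.
\<close>

lemma decreasing_of_recurrence:
  fixes f a :: "nat \<Rightarrow> real"
  assumes rec: "\<And>k. f (Suc (Suc k)) = a k * f (Suc k) - f k"
    and a: "\<And>k. k \<ge> m \<Longrightarrow> a k \<ge> 2" and lim: "f \<longlonglongrightarrow> 0" and n: "n \<ge> m"
  shows "\<bar>f (Suc n)\<bar> \<le> \<bar>f n\<bar>"
proof (rule ccontr)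
  assume "\<not> ?thesis"
  hence gt: "\<bar>f (Suc n)\<bar> > \<bar>f n\<bar>" by simp
  \<comment> \<open>Once the absolute value has grown, a coefficient of at least 2 keeps it from
    shrinking: the next value is at least twice the current one minus the previous one. This bounds
    the sequence away from 0.\<close>
  have "\<bar>f (Suc n + k)\<bar> \<ge> \<bar>f (n + k)\<bar> \<and> \<bar>f (Suc n + k)\<bar> \<ge> \<bar>f (Suc n)\<bar>" for k
  proof (induction k)
    case (Suc k)
    have "2 * \<bar>f (Suc (n + k))\<bar> \<le> \<bar>a (n + k)\<bar> * \<bar>f (Suc (n + k))\<bar>"
      using a[of "n + k"] n by (intro mult_right_mono) auto
    also have "\<dots> = \<bar>f (Suc (Suc (n + k))) + f (n + k)\<bar>"
      unfolding rec[of "n + k"] by (simp add: abs_mult)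
    also have "\<dots> \<le> \<bar>f (Suc (Suc (n + k)))\<bar> + \<bar>f (n + k)\<bar>" by (rule abs_triangle_ineq)
    finally show ?case using Suc.IH by simp
  qed (use gt in simp)
  hence "\<bar>f (Suc n)\<bar> \<le> \<bar>f (k + Suc n)\<bar>" for k by (metis add.commute)
  moreover have "(\<lambda>k. \<bar>f (k + Suc n)\<bar>) \<longlonglongrightarrow> 0"
    using LIMSEQ_ignore_initial_segment[OF tendsto_rabs_zero[OF lim]] .
  ultimately have "\<bar>f (Suc n)\<bar> \<le> 0"
    by (intro LIMSEQ_le_const) auto
  thus False using gt by simp
qed

lemma spherical_j_recurrence:
  assumes "x > 0"
  shows "spherical_j (Suc (Suc n)) x = (2 * real n + 3) / x * spherical_j (Suc n) x - spherical_j n x"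
proof -
  have "bessel_J (real (Suc (Suc n)) + 1 / 2) x
    = (2 * real n + 3) / x * bessel_J (real (Suc n) + 1 / 2) x - bessel_J (real n + 1 / 2) x"
    using bessel_J_half_integer_recurrence[OF assms, of "Suc n"] by (simp add: add_ac)
  thus ?thesis
    unfolding spherical_j_def by (simp only: right_diff_distrib mult.left_commute)
qed

lemma spherical_j_tendsto_0_order:
  assumes "x > 0"
  shows "(\<lambda>n. spherical_j n x) \<longlonglongrightarrow> 0"
  using tendsto_mult_right_zero[OF bessel_J_tendsto_0_order[OF assms, of "1 / 2"]]
  by (simp add: spherical_j_def add.commute)

section \<open>Upper and lower bounds for the polynomial\<close>

lemma falling_rising_bounds:
  assumes "i \<le> Suc n"
  shows "0 \<le> falling_rising (real n) i" "falling_rising (real n) i \<le> ((real n + 1 / 2)\<^sup>2) ^ i"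
proof -
  have 1: "0 \<le> (real n - real l) * (real n + real l + 1)" if "l < i" for l
    using that assms by (intro mult_nonneg_nonneg) auto
  thus "0 \<le> falling_rising (real n) i"
    unfolding falling_rising_def by (intro prod_nonneg) auto
  \<comment> \<open>Completing the square, whence the shift by \<open>1 / 2\<close> in the
    bound.\<close>
  have "(real n - real l) * (real n + real l + 1) = (real n + 1 / 2)\<^sup>2 - (real l + 1 / 2)\<^sup>2" for l
    by (simp add: power2_eq_square algebra_simps)
  hence "falling_rising (real n) i \<le> (\<Prod>l<i. (real n + 1 / 2)\<^sup>2)"
    unfolding falling_rising_def using 1 by (intro prod_mono) auto
  thus "falling_rising (real n) i \<le> ((real n + 1 / 2)\<^sup>2) ^ i" by simp
qed

text \<open>Bounding every \<open>half_binomial\<close> by 1 leaves a geometric sum, with ratio at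
  most 1 as soon as \<open>x \<ge> n + 1 / 2\<close>.\<close>

lemma spherical_sum_squares_le:
  assumes x: "x > 0"
  shows "(spherical_y n x)\<^sup>2 + (spherical_j n x)\<^sup>2 \<le> (\<Sum>i\<le>n. (((real n + 1 / 2) / x)\<^sup>2) ^ i) / x\<^sup>2"
  unfolding spherical_sum_squares[OF x]
proof (intro divide_right_mono sum_mono)
  fix i assume i: "i \<in> {..n}"
  have "half_binomial i * falling_rising (real n) i \<le> 1 * ((real n + 1 / 2)\<^sup>2) ^ i"
    using i by (intro mult_mono half_binomial_le_1 falling_rising_bounds) auto
  hence "half_binomial i * falling_rising (real n) i / x ^ (2 * i) \<le> ((real n + 1 / 2)\<^sup>2) ^ i / (x\<^sup>2) ^ i"
    using x by (simp add: power_mult divide_right_mono)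
  thus "half_binomial i * falling_rising (real n) i / x ^ (2 * i) \<le> (((real n + 1 / 2) / x)\<^sup>2) ^ i"
    by (simp add: power_divide)
qed simp

lemma spherical_sum_squares_ge:
  assumes x: "x > 0" and i: "i \<le> n"
  shows "half_binomial i * falling_rising (real n) i / x ^ (2 * i) / x\<^sup>2
    \<le> (spherical_y n x)\<^sup>2 + (spherical_j n x)\<^sup>2"
  unfolding spherical_sum_squares[OF x] using x i
  by (intro divide_right_mono member_le_sum divide_nonneg_nonneg mult_nonneg_nonneg
      falling_rising_bounds less_imp_le[OF half_binomial_pos]) auto

lemma spherical_j_power2_le:
  assumes x: "1 \<le> x" "x \<le> real n"
  shows "(spherical_j n x)\<^sup>2 \<le> 2"
proof -
  \<comment> \<open>The turning point: \<open>m + 1 / 2 \<le> x\<close> keeps the geometric ratio at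
    index \<open>m\<close> at most 1, and \<open>x < m + 3 / 2\<close> makes the recurrence
    coefficients at least 2 from \<open>m\<close> on.\<close>
  define m where "m = nat \<lfloor>x - 1 / 2\<rfloor>"
  have m: "real m + 1 / 2 \<le> x" "x < real m + 3 / 2"
    unfolding m_def using x by linarith+
  have dec: "\<bar>spherical_j (Suc k) x\<bar> \<le> \<bar>spherical_j k x\<bar>" if "k \<ge> m" for k
    using _ _ _ that
  proof (rule decreasing_of_recurrence)
    show "2 \<le> (2 * real k + 3) / x" if "m \<le> k" for k
      using that m x by (simp add: pos_le_divide_eq)
  qed (use x in \<open>simp_all add: spherical_j_recurrence spherical_j_tendsto_0_order\<close>)
  have "m \<le> n" using m x by linarith
  hence "\<bar>spherical_j n x\<bar> \<le> \<bar>spherical_j m x\<bar>"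
  proof (induction rule: dec_induct)
    case (step k)
    thus ?case using dec[of k] by simp
  qed simp
  hence "(spherical_j n x)\<^sup>2 \<le> (spherical_j m x)\<^sup>2" by (simp add: abs_le_square_iff)
  also have "\<dots> \<le> (spherical_y m x)\<^sup>2 + (spherical_j m x)\<^sup>2" by simp
  also have "\<dots> \<le> (\<Sum>i\<le>m. (((real m + 1 / 2) / x)\<^sup>2) ^ i) / x\<^sup>2"
    using x by (intro spherical_sum_squares_le) auto
  also have "\<dots> \<le> (\<Sum>i\<le>m. 1) / x\<^sup>2"
    using m x by (intro divide_right_mono sum_mono power_le_one) (auto simp: power_le_one)
  also have "\<dots> \<le> 2"
  proof -
    have "x \<le> x\<^sup>2" using x by (simp add: power2_eq_square)
    hence "real m + 1 \<le> 2 * x\<^sup>2" using m x by linarith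
    thus ?thesis using x by (simp add: divide_le_eq add.commute)
  qed
  finally show ?thesis .
qed

text \<open>For \<open>l < n div K\<close> one has \<open>l \<le> n / K\<close>, so each factor is
  at least the square of \<open>n\<close> minus the square of \<open>l\<close>.\<close>

lemma falling_rising_ge:
  assumes K: "K > 0"
  shows "((1 - 1 / (real K)\<^sup>2) * (real n)\<^sup>2) ^ (n div K) \<le> falling_rising (real n) (n div K)"
proof -
  have "(1 - 1 / (real K)\<^sup>2) * (real n)\<^sup>2 \<le> (real n - real l) * (real n + real l + 1)"
    if "l < n div K" for l
  proof -
    have "l * K \<le> n" using that K
      by (metis less_imp_le less_eq_div_iff_mult_less_eq)
    hence lK: "real l * real K \<le> real n" by (metis of_nat_le_iff of_nat_mult)
    hence "(real l * real K)\<^sup>2 \<le> (real n)\<^sup>2" by (intro power_mono) auto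
    hence "(real l)\<^sup>2 \<le> (real n)\<^sup>2 / (real K)\<^sup>2"
      using K by (simp add: power_mult_distrib pos_le_divide_eq)
    moreover have "real l \<le> real n"
      using that by (meson div_le_dividend le_trans less_imp_le of_nat_le_iff)
    ultimately show ?thesis by (simp add: power2_eq_square algebra_simps)
  qed
  moreover have "1 / (real K)\<^sup>2 \<le> 1" using K by (simp add: divide_le_eq)
  ultimately have "(\<Prod>l<n div K. (1 - 1 / (real K)\<^sup>2) * (real n)\<^sup>2) \<le> falling_rising (real n) (n div K)"
    unfolding falling_rising_def by (intro prod_mono) auto
  thus ?thesis by simp
qed

lemma spherical_sum_squares_at_top:
  assumes \<beta>: "0 < \<beta>" "\<beta> < 1"
  shows "filterlim (\<lambda>n. (spherical_y n (\<beta> * real n))\<^sup>2 + (spherical_j n (\<beta> * real n))\<^sup>2) at_top sequentially"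
proof -
  have "\<beta>\<^sup>2 < 1" using \<beta> by (simp add: power_less_one_iff)
  \<comment> \<open>Large enough that \<open>1 / K\<close>, and hence the smaller inverse square of
    \<open>K\<close>, lies below the gap between 1 and the square of \<open>\<beta>\<close>.\<close>
  obtain K where K': "1 / (1 - \<beta>\<^sup>2) < real K" using reals_Archimedean2 by blast
  have K0: "real K > 0" using K' \<open>\<beta>\<^sup>2 < 1\<close> by (smt (verit) divide_pos_pos)
  hence K: "K > 0" by simp
  have "1 / (real K)\<^sup>2 \<le> 1 / real K"
    using K by (intro divide_left_mono) (auto simp: power2_eq_square)
  also have "1 / real K < 1 - \<beta>\<^sup>2"
    using K' K0 \<open>\<beta>\<^sup>2 < 1\<close> by (simp add: divide_less_eq mult.commute)
  finally have K2: "\<beta>\<^sup>2 < 1 - 1 / (real K)\<^sup>2" by simp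
  \<comment> \<open>A lower bound for the growth per factor: the term of index
    \<open>n div K\<close> is at least \<open>q ^ (n div K)\<close>, up to
    \<open>half_binomial\<close>.\<close>
  define q where "q = (1 - 1 / (real K)\<^sup>2) / \<beta>\<^sup>2"
  define c where "c = ln q"
  have q: "q > 1" unfolding q_def using K2 \<beta> by (simp add: less_divide_eq)
  hence c: "c > 0" unfolding c_def by simp
  have low: "exp (c * (real n / real K - 1)) / ((2 * real n + 1) * (\<beta> * real n)\<^sup>2)
     \<le> (spherical_y n (\<beta> * real n))\<^sup>2 + (spherical_j n (\<beta> * real n))\<^sup>2" if n: "n > 0" for n
  proof -
    define i where "i = n div K"
    have i: "i \<le> n" unfolding i_def by simp
    \<comment> \<open>Removes the rounding in \<open>n div K\<close>, so that the lower bound is an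
      elementary function of \<open>n\<close>.\<close>
    have "real n / real K - 1 \<le> real i"
      unfolding i_def using floor_divide_of_nat_eq[of n K, where 'a = real] by linarith
    hence "exp (c * (real n / real K - 1)) \<le> exp (real i * c)"
      using c by (simp add: mult.commute)
    also have "\<dots> = q ^ i"
      unfolding c_def exp_of_nat_mult using q by simp
    also have "q ^ i = ((1 - 1 / (real K)\<^sup>2) * (real n)\<^sup>2) ^ i / (\<beta> * real n) ^ (2 * i)"
      unfolding q_def using n \<beta> by (simp add: power_mult power_divide[symmetric] power_mult_distrib)
    also have "\<dots> \<le> falling_rising (real n) i / (\<beta> * real n) ^ (2 * i)"
      unfolding i_def using \<beta> by (intro divide_right_mono falling_rising_ge K) simp
    finally have 1: "exp (c * (real n / real K - 1)) \<le> falling_rising (real n) i / (\<beta> * real n) ^ (2 * i)" .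
    have "1 / (2 * real n + 1) \<le> 1 / (2 * real i + 1)"
      using i by (intro divide_left_mono) auto
    also have "\<dots> \<le> half_binomial i" by (rule half_binomial_ge)
    finally have "1 / (2 * real n + 1) * exp (c * (real n / real K - 1))
      \<le> half_binomial i * (falling_rising (real n) i / (\<beta> * real n) ^ (2 * i))"
      using 1 half_binomial_pos[of i] by (intro mult_mono) auto
    hence "1 / (2 * real n + 1) * exp (c * (real n / real K - 1)) / (\<beta> * real n)\<^sup>2
      \<le> half_binomial i * (falling_rising (real n) i / (\<beta> * real n) ^ (2 * i)) / (\<beta> * real n)\<^sup>2"
      by (rule divide_right_mono) simp
    also have "\<dots> \<le> (spherical_y n (\<beta> * real n))\<^sup>2 + (spherical_j n (\<beta> * real n))\<^sup>2"
      using spherical_sum_squares_ge[of "\<beta> * real n" i n] \<beta> n i by simp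
    finally show ?thesis by simp
  qed
  have "filterlim (\<lambda>n. exp (c * (real n / real K - 1)) / ((2 * real n + 1) * (\<beta> * real n)\<^sup>2)) at_top sequentially"
    using c K0 \<beta>(1) by real_asymp
  thus ?thesis
    by (rule filterlim_at_top_mono) (rule eventually_mono[OF eventually_gt_at_top[of 0] low])
qed

section \<open>Limits of the power ratio\<close>

lemma power_ratio_tendsto_half:
  assumes \<beta>: "0 < \<beta>" "\<beta> < 1"
  shows "(\<lambda>n. P_L n (\<beta> * real n) / P_T n (\<beta> * real n)) \<longlonglongrightarrow> 1 / 2"
proof -
  define j2 where "j2 = (\<lambda>n. (spherical_j n (\<beta> * real n))\<^sup>2)"
  define M where "M = (\<lambda>n. (spherical_y n (\<beta> * real n))\<^sup>2 + (spherical_j n (\<beta> * real n))\<^sup>2)"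
  have M: "filterlim M at_top sequentially"
    unfolding M_def by (rule spherical_sum_squares_at_top[OF \<beta>])
  have "filterlim (\<lambda>n. 2 * real n + 1) at_top sequentially" by real_asymp
  hence NM: "filterlim (\<lambda>n. (2 * real n + 1) * M n) at_top sequentially"
    using M by (rule filterlim_at_top_mult_at_top)
  have "\<forall>\<^sub>F n in sequentially. 1 \<le> \<beta> * real n" using \<beta>(1) by real_asymp
  hence j2: "\<forall>\<^sub>F n in sequentially. j2 n \<le> 2"
  proof (rule eventually_mono)
    fix n assume "1 \<le> \<beta> * real n"
    moreover have "\<beta> * real n \<le> real n" using \<beta> by (simp add: mult_left_le_one_le)
    ultimately show "j2 n \<le> 2" unfolding j2_def by (rule spherical_j_power2_le)
  qed
  have Mpos: "\<forall>\<^sub>F n in sequentially. 0 < M n"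
    using M by (simp add: filterlim_at_top_dense)
  have "(\<lambda>n. j2 n / M n) \<longlonglongrightarrow> 0"
  proof (rule Lim_null_comparison)
    show "\<forall>\<^sub>F n in sequentially. norm (j2 n / M n) \<le> 2 / M n"
      using j2 Mpos by eventually_elim (simp add: divide_right_mono j2_def)
    show "(\<lambda>n. 2 / M n) \<longlonglongrightarrow> 0"
      by (rule tendsto_divide_0[OF tendsto_const filterlim_at_top_imp_at_infinity[OF M]])
  qed
  moreover have "(\<lambda>n. 1 / ((2 * real n + 1) * M n)) \<longlonglongrightarrow> 0"
    by (rule tendsto_divide_0[OF tendsto_const filterlim_at_top_imp_at_infinity[OF NM]])
  \<comment> \<open>Numerator and denominator are divided by \<open>(2 * n + 1) * M n\<close>; the
    difference of squares in \<open>P_S\<close> is \<open>M n - 2 * j2 n\<close>.\<close>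
  ultimately have "(\<lambda>n. (3 / 32) / (1 / ((2 * real n + 1) * M n) + 3 / 16 * (1 - 2 * (j2 n / M n))))
      \<longlonglongrightarrow> (3 / 32) / (0 + 3 / 16 * (1 - 2 * 0))"
    by (intro tendsto_intros) auto
  hence "(\<lambda>n. (3 / 32) / (1 / ((2 * real n + 1) * M n) + 3 / 16 * (1 - 2 * (j2 n / M n)))) \<longlonglongrightarrow> 1 / 2"
    by simp
  moreover have "\<forall>\<^sub>F n in sequentially.
      (3 / 32) / (1 / ((2 * real n + 1) * M n) + 3 / 16 * (1 - 2 * (j2 n / M n)))
      = P_L n (\<beta> * real n) / P_T n (\<beta> * real n)"
    using Mpos
  proof eventually_elim
    case (elim n)
    define u where "u = (2 * real n + 1) * M n"
    have u: "u > 0" unfolding u_def using elim by simp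
    have L: "P_L n (\<beta> * real n) = 3 / 32 * u"
      by (simp add: P_L_def u_def M_def)
    have "M n * (1 - 2 * (j2 n / M n)) = M n - 2 * j2 n"
      using elim by (simp add: algebra_simps)
    hence "u * (1 - 2 * (j2 n / M n)) = (2 * real n + 1) * (M n - 2 * j2 n)"
      by (simp add: u_def mult.assoc)
    moreover have "P_S n (\<beta> * real n) = 3 / 16 * ((2 * real n + 1) * (M n - 2 * j2 n))"
      by (simp add: P_S_def M_def j2_def)
    ultimately have "P_S n (\<beta> * real n) = u * (3 / 16 * (1 - 2 * (j2 n / M n)))"
      by (simp only: mult.left_commute[of u])
    hence "P_T n (\<beta> * real n) = u * (1 / u + 3 / 16 * (1 - 2 * (j2 n / M n)))"
      using u by (simp only: P_T_def distrib_left) simp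
    thus ?case unfolding L u_def[symmetric] using u by simp
  qed
  ultimately show ?thesis by (rule Lim_transform_eventually)
qed

lemma power_ratio_tendsto_0:
  assumes \<beta>: "\<beta> > 1"
  shows "(\<lambda>n. P_L n (\<beta> * real n) / P_T n (\<beta> * real n)) \<longlonglongrightarrow> 0"
proof -
  \<comment> \<open>The midpoint of \<open>1 / \<beta>\<close> and 1: the ratio
    \<open>(n + 1 / 2) / (\<beta> * n)\<close> tends to \<open>1 / \<beta>\<close>, so it is
    eventually below \<open>r\<close>, giving a convergent geometric series independent of
    \<open>n\<close>.\<close>
  define r where "r = (1 / \<beta> + 1) / 2"
  have r: "1 / \<beta> < r" "0 < r" "r < 1" unfolding r_def using \<beta> by (simp_all add: field_simps)
  have r2: "r\<^sup>2 < 1" using r by (simp add: power_less_one_iff)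
  have "(\<lambda>n. (real n + 1 / 2) / (\<beta> * real n)) \<longlonglongrightarrow> inverse \<beta>"
    using \<beta> by real_asymp
  hence "\<forall>\<^sub>F n in sequentially. (real n + 1 / 2) / (\<beta> * real n) < r"
    using r(1) by (intro order_tendstoD) (simp_all add: inverse_eq_divide)
  moreover have "\<forall>\<^sub>F n in sequentially. n > 0" by (rule eventually_gt_at_top)
  ultimately have bound: "\<forall>\<^sub>F n in sequentially. norm (P_L n (\<beta> * real n))
      \<le> 3 / 32 * (2 * real n + 1) * (1 / (1 - r\<^sup>2) / (\<beta> * real n)\<^sup>2)"
  proof eventually_elim
    case (elim n)
    have x: "\<beta> * real n > 0" using elim \<beta> by simp
    have "(spherical_y n (\<beta> * real n))\<^sup>2 + (spherical_j n (\<beta> * real n))\<^sup>2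
      \<le> (\<Sum>i\<le>n. (((real n + 1 / 2) / (\<beta> * real n))\<^sup>2) ^ i) / (\<beta> * real n)\<^sup>2"
      by (rule spherical_sum_squares_le[OF x])
    also have "\<dots> \<le> (\<Sum>i\<le>n. (r\<^sup>2) ^ i) / (\<beta> * real n)\<^sup>2"
      using elim x by (intro divide_right_mono sum_mono power_mono) auto
    also have "\<dots> \<le> (\<Sum>i. (r\<^sup>2) ^ i) / (\<beta> * real n)\<^sup>2"
      using r2 by (intro divide_right_mono sum_le_suminf summable_geometric) auto
    also have "\<dots> = 1 / (1 - r\<^sup>2) / (\<beta> * real n)\<^sup>2"
      using r2 by (simp add: suminf_geometric)
    finally have "P_L n (\<beta> * real n) \<le> 3 / 32 * (2 * real n + 1) * (1 / (1 - r\<^sup>2) / (\<beta> * real n)\<^sup>2)"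
      unfolding P_L_def by (rule mult_left_mono) simp
    moreover have "0 \<le> P_L n (\<beta> * real n)" by (simp add: P_L_def)
    ultimately show ?case by simp
  qed
  have "(\<lambda>n. 3 / 32 * (2 * real n + 1) * (1 / (1 - r\<^sup>2) / (\<beta> * real n)\<^sup>2)) \<longlonglongrightarrow> 0"
    using \<beta> r2 by real_asymp
  with bound have L: "(\<lambda>n. P_L n (\<beta> * real n)) \<longlonglongrightarrow> 0"
    by (rule Lim_null_comparison)
  \<comment> \<open>Makes \<open>P_S\<close> vanish along with \<open>P_L\<close>, so the
    denominator tends to 1.\<close>
  have "norm (P_S n x) \<le> 2 * P_L n x" for n x
  proof -
    have "\<bar>(spherical_y n x)\<^sup>2 - (spherical_j n x)\<^sup>2\<bar> \<le> (spherical_y n x)\<^sup>2 + (spherical_j n x)\<^sup>2"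
      by (simp add: abs_le_iff)
    hence "3 / 16 * (2 * real n + 1) * \<bar>(spherical_y n x)\<^sup>2 - (spherical_j n x)\<^sup>2\<bar>
      \<le> 3 / 16 * (2 * real n + 1) * ((spherical_y n x)\<^sup>2 + (spherical_j n x)\<^sup>2)"
      by (rule mult_left_mono) simp
    thus ?thesis by (simp add: P_S_def P_L_def abs_mult)
  qed
  hence "(\<lambda>n. P_S n (\<beta> * real n)) \<longlonglongrightarrow> 0"
    by (intro Lim_null_comparison[OF _ tendsto_mult_right_zero[OF L, of 2]] always_eventually) blast
  hence "(\<lambda>n. P_T n (\<beta> * real n)) \<longlonglongrightarrow> 1 + 0"
    unfolding P_T_def by (intro tendsto_intros)
  from tendsto_divide[OF L this] show ?thesis by simp
qed

theorem mainTheorem4: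
  fixes \<beta> :: real and k\<^sub>0 R\<^sub>2 :: "nat \<Rightarrow> real"
  assumes "\<beta> > 0"
    and "\<And>n. n \<ge> 1 \<Longrightarrow> k\<^sub>0 n > 0"
    and "\<And>n. n \<ge> 1 \<Longrightarrow> R\<^sub>2 n > 0"
    and "\<And>n. n \<ge> 1 \<Longrightarrow> k\<^sub>0 n * R\<^sub>2 n = \<beta> * real n"
  shows "(\<beta> < 1 \<longrightarrow>
            (\<lambda>n. P_L n (k\<^sub>0 n * R\<^sub>2 n) / P_T n (k\<^sub>0 n * R\<^sub>2 n)) \<longlonglongrightarrow> 1 / 2) \<and>
         (\<beta> > 1 \<longrightarrow>
            (\<lambda>n. P_L n (k\<^sub>0 n * R\<^sub>2 n) / P_T n (k\<^sub>0 n * R\<^sub>2 n)) \<longlonglongrightarrow> 0)"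
proof -
  \<comment> \<open>The product is prescribed only for \<open>n \<ge> 1\<close>, so the sequences
    are compared eventually.\<close>
  have ev: "\<forall>\<^sub>F n in sequentially. P_L n (\<beta> * real n) / P_T n (\<beta> * real n)
      = P_L n (k\<^sub>0 n * R\<^sub>2 n) / P_T n (k\<^sub>0 n * R\<^sub>2 n)"
    using eventually_ge_at_top[of 1] by eventually_elim (simp add: assms(4))
  show ?thesis
    using Lim_transform_eventually[OF power_ratio_tendsto_half[OF assms(1)] ev]
      Lim_transform_eventually[OF power_ratio_tendsto_0 ev] by blast
qed

end
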